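(* If $H$ is a free factor of a finitely generated free group $F$, then $H$ is profinitely rigid in $F$ if and only if it is setwise profinitely rigid in $F$.
   Context: For a finitely generated subgroup $H\le F$, a finite group $K$ and $h\in\mathrm{Hom}(H,K)$, put $\Pr_{H,K}(h)=|\{f\in\mathrm{Hom}(F,K): f|_H=h\}|/|\mathrm{Hom}(F,K)|$. An isomorphism $\alpha\colon H_1\to H_2$ between finitely generated subgroups of $F$ is a measure equivalence if $\Pr_{H_2,K}(h)=\Pr_{H_1,K}(h\circ\alpha)$ for every finite group $K$ and every $h\in\mathrm{Hom}(H_2,K)$; $H_1,H_2$ are measure equivalent if such an $\alpha$ exists. $H$ is profinitely rigid in $F$ if, whenever $L\le F$ is finitely generated and $\alpha\colon H\to L$ is a measure equivalence, there exists $\varphi\in\mathrm{Aut}(F)$ with $\varphi(H)=L$ and $\varphi|_H=\alpha$. $H$ is setwise profinitely rigid in $F$ if every finitely generated $L\le F$ measure equivalent to $H$ is of the form $L=\varphi(H)$ for some $\varphi\in\mathrm{Aut}(F)$. *)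

theory Defs
  imports "HOL-Algebra.Algebra" Complex_Main
begin

definition fg_subgroup :: "'a set \<Rightarrow> ('a, 'b) monoid_scheme \<Rightarrow> bool" where
  "fg_subgroup H F \<longleftrightarrow>
     subgroup H F \<and> (\<exists>A. finite A \<and> A \<subseteq> carrier F \<and> generate F A = H)"

definition word_prod :: "('a, 'b) monoid_scheme \<Rightarrow> 'a list \<Rightarrow> 'a" where
  "word_prod G ws = foldr (\<otimes>\<^bsub>G\<^esub>) ws \<one>\<^bsub>G\<^esub>"

(* The letter (True, s) stands for s and (False, s) for the inverse of s. *)

fun letter_val :: "('a, 'b) monoid_scheme \<Rightarrow> bool \<times> 'a \<Rightarrow> 'a" where
  "letter_val G (e, s) = (if e then s else inv\<^bsub>G\<^esub> s)"

fun cancelling :: "bool \<times> 'a \<Rightarrow> bool \<times> 'a \<Rightarrow> bool" where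
  "cancelling (e, s) (d, t) \<longleftrightarrow> s = t \<and> e \<noteq> d"

definition freely_reduced :: "'a set \<Rightarrow> (bool \<times> 'a) list \<Rightarrow> bool" where
  "freely_reduced S w \<longleftrightarrow>
     snd ` set w \<subseteq> S \<and> successively (\<lambda>x y. \<not> cancelling x y) w"

(* Freeness is stated through reduced words and not through the universal property,
   since a definition in HOL cannot quantify over the groups of all types. *)

definition free_basis :: "('a, 'b) monoid_scheme \<Rightarrow> 'a set \<Rightarrow> bool" where
  "free_basis G S \<longleftrightarrow> S \<subseteq> carrier G \<and>
     (\<forall>x\<in>carrier G. \<exists>!w. freely_reduced S w \<and> word_prod G (map (letter_val G) w) = x)"

definition free_group :: "('a, 'b) monoid_scheme \<Rightarrow> bool" where
  "free_group G \<longleftrightarrow> group G \<and> (\<exists>S. free_basis G S)"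

definition fg_free_group :: "('a, 'b) monoid_scheme \<Rightarrow> bool" where
  "fg_free_group G \<longleftrightarrow> free_group G \<and> fg_subgroup (carrier G) G"

(* Reduced words of a free product: nontrivial entries taken alternately from the two factors.
   The alternation condition says this only for factors with trivial intersection. *)

definition alternating_word ::
  "('a, 'b) monoid_scheme \<Rightarrow> 'a set \<Rightarrow> 'a set \<Rightarrow> 'a list \<Rightarrow> bool" where
  "alternating_word G H M w \<longleftrightarrow>
     set w \<subseteq> (H \<union> M) - {\<one>\<^bsub>G\<^esub>} \<and> successively (\<lambda>x y. x \<in> H \<longleftrightarrow> y \<in> M) w"

definition internal_free_product ::
  "('a, 'b) monoid_scheme \<Rightarrow> 'a set \<Rightarrow> 'a set \<Rightarrow> bool" where
  "internal_free_product G H M \<longleftrightarrow>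
     subgroup H G \<and> subgroup M G \<and> H \<inter> M = {\<one>\<^bsub>G\<^esub>} \<and>
     (\<forall>x\<in>carrier G. \<exists>!w. alternating_word G H M w \<and> word_prod G w = x)"

definition free_factor :: "'a set \<Rightarrow> ('a, 'b) monoid_scheme \<Rightarrow> bool" where
  "free_factor H F \<longleftrightarrow> (\<exists>M. internal_free_product F H M)"

(* hom F K itself constrains its members only on the carrier of F, so it contains many functions
   for each homomorphism; extensional representatives make the cardinalities meaningful. *)

definition Hom :: "('a, 'b) monoid_scheme \<Rightarrow> ('k, 'c) monoid_scheme \<Rightarrow> ('a \<Rightarrow> 'k) set" where
  "Hom F K = hom F K \<inter> extensional (carrier F)"

definition Pr ::
  "('a, 'b) monoid_scheme \<Rightarrow> 'a set \<Rightarrow> ('k, 'c) monoid_scheme \<Rightarrow> ('a \<Rightarrow> 'k) \<Rightarrow> real" where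
  "Pr F H K h = real (card {f \<in> Hom F K. \<forall>x\<in>H. f x = h x}) / real (card (Hom F K))"

(* Every finite group is isomorphic to one with carrier in nat, and Pr is invariant under
   isomorphisms of K, so testing on groups over nat is no restriction; the lemma
   measure_equivalence_any_type below confirms this. *)

definition measure_equivalence ::
  "('a, 'b) monoid_scheme \<Rightarrow> 'a set \<Rightarrow> 'a set \<Rightarrow> ('a \<Rightarrow> 'a) \<Rightarrow> bool" where
  "measure_equivalence F H\<^sub>1 H\<^sub>2 \<alpha> \<longleftrightarrow>
     fg_subgroup H\<^sub>1 F \<and> fg_subgroup H\<^sub>2 F \<and>
     \<alpha> \<in> iso (F\<lparr>carrier := H\<^sub>1\<rparr>) (F\<lparr>carrier := H\<^sub>2\<rparr>) \<and>
     (\<forall>K :: nat monoid. group K \<and> finite (carrier K) \<longrightarrow>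
       (\<forall>h \<in> hom (F\<lparr>carrier := H\<^sub>2\<rparr>) K. Pr F H\<^sub>2 K h = Pr F H\<^sub>1 K (h \<circ> \<alpha>)))"

definition measure_equivalent ::
  "('a, 'b) monoid_scheme \<Rightarrow> 'a set \<Rightarrow> 'a set \<Rightarrow> bool" where
  "measure_equivalent F H\<^sub>1 H\<^sub>2 \<longleftrightarrow> (\<exists>\<alpha>. measure_equivalence F H\<^sub>1 H\<^sub>2 \<alpha>)"

definition profinitely_rigid :: "'a set \<Rightarrow> ('a, 'b) monoid_scheme \<Rightarrow> bool" where
  "profinitely_rigid H F \<longleftrightarrow>
     (\<forall>L \<alpha>. fg_subgroup L F \<and> measure_equivalence F H L \<alpha> \<longrightarrow>
       (\<exists>\<phi> \<in> auto F. \<phi> ` H = L \<and> (\<forall>x\<in>H. \<phi> x = \<alpha> x)))"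

definition setwise_profinitely_rigid :: "'a set \<Rightarrow> ('a, 'b) monoid_scheme \<Rightarrow> bool" where
  "setwise_profinitely_rigid H F \<longleftrightarrow>
     (\<forall>L. fg_subgroup L F \<and> measure_equivalent F H L \<longrightarrow> (\<exists>\<phi> \<in> auto F. L = \<phi> ` H))"

lemma Pr_iso:
  assumes F: "group F" and H: "H \<subseteq> carrier F" and K: "group K" and K': "group K'"
    and g: "g \<in> iso K K'" and h: "h \<in> H \<rightarrow> carrier K"
  shows "Pr F H K' (g \<circ> h) = Pr F H K h"
proof -
  define T where "T f = restrict (g \<circ> f) (carrier F)" for f
  define g' where "g' = inv_into (carrier K) g"
  have g': "g' \<in> iso K' K" using group.iso_set_sym[OF K g] by (simp add: g'_def)
  have gb: "bij_betw g (carrier K) (carrier K')" and gh: "g \<in> hom K K'"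
    using g by (auto simp: iso_def)
  have gg: "g' (g x) = x" if "x \<in> carrier K" for x
    using gb that by (simp add: g'_def bij_betw_inv_into_left)
  have gg2: "g (g' x) = x" if "x \<in> carrier K'" for x
    using gb that by (simp add: g'_def bij_betw_inv_into_right)
  have g'h: "g' \<in> hom K' K" using g' by (auto simp: iso_def)
  have bij: "bij_betw T (Hom F K) (Hom F K')"
  proof (rule bij_betw_byWitness[where f' = "\<lambda>f. restrict (g' \<circ> f) (carrier F)"])
    show "\<forall>a\<in>Hom F K. restrict (g' \<circ> T a) (carrier F) = a"
      using gg by (auto simp: T_def Hom_def hom_def fun_eq_iff extensional_def Pi_iff)
    show "\<forall>a'\<in>Hom F K'. T (restrict (g' \<circ> a') (carrier F)) = a'"
      using gg2 by (auto simp: T_def Hom_def hom_def fun_eq_iff extensional_def Pi_iff)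
    show "T ` Hom F K \<subseteq> Hom F K'"
      using gh F by (auto simp: T_def Hom_def hom_def Pi_iff group.is_monoid monoid.m_closed)
    show "(\<lambda>f. restrict (g' \<circ> f) (carrier F)) ` Hom F K' \<subseteq> Hom F K"
      using g'h F by (auto simp: Hom_def hom_def Pi_iff group.is_monoid monoid.m_closed)
  qed
  have eq: "(\<forall>x\<in>H. T f x = (g \<circ> h) x) \<longleftrightarrow> (\<forall>x\<in>H. f x = h x)" if f: "f \<in> Hom F K" for f
  proof (rule ball_cong[OF refl])
    fix x assume x: "x \<in> H"
    have "f x \<in> carrier K" "h x \<in> carrier K" "x \<in> carrier F"
      using f h x H by (auto simp: Hom_def hom_def)
    then show "T f x = (g \<circ> h) x \<longleftrightarrow> f x = h x"
      using gg by (metis T_def comp_apply restrict_apply')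
  qed
  have "bij_betw T {f \<in> Hom F K. \<forall>x\<in>H. f x = h x} {f \<in> Hom F K'. \<forall>x\<in>H. f x = (g \<circ> h) x}"
  proof -
    have "T ` {f \<in> Hom F K. \<forall>x\<in>H. f x = h x} = {f \<in> Hom F K'. \<forall>x\<in>H. f x = (g \<circ> h) x}"
      (is "T ` ?A = ?B")
    proof
      show "T ` ?A \<subseteq> ?B" using eq bij by (auto simp: bij_betw_def)
      show "?B \<subseteq> T ` ?A"
      proof
        fix f assume "f \<in> ?B"
        then obtain e where "e \<in> Hom F K" "f = T e" using bij by (auto simp: bij_betw_def)
        then show "f \<in> T ` ?A" using eq[of e] \<open>f \<in> ?B\<close> by blast
      qed
    qed
    then show ?thesis using bij by (auto simp: bij_betw_def intro: inj_on_subset)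
  qed
  then show ?thesis using bij by (simp add: Pr_def bij_betw_same_card)
qed

lemma finite_group_iso_nat:
  assumes "group K" and "finite (carrier K)"
  obtains K' :: "nat monoid" and g where "group K'" "finite (carrier K')" "g \<in> iso K K'"
proof -
  obtain g :: "_ \<Rightarrow> nat" where inj: "inj_on g (carrier K)"
    using assms(2) by (meson finite_imp_inj_to_nat_seg)
  let ?i = "inv_into (carrier K) g"
  define K' :: "nat monoid" where
    "K' = \<lparr>carrier = g ` carrier K, monoid.mult = \<lambda>x y. g (?i x \<otimes>\<^bsub>K\<^esub> ?i y), one = g \<one>\<^bsub>K\<^esub>\<rparr>"
  have iso: "g \<in> iso K K'"
    using inj by (auto simp: iso_def hom_def K'_def bij_betw_def)
  interpret K: group K by fact
  have "group K'"
    by (rule groupI) (use inj in \<open>auto simp: K'_def K.m_assoc intro!: bexI[OF _ K.inv_closed]\<close>)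
  moreover have "finite (carrier K')" using assms(2) by (simp add: K'_def)
  ultimately show ?thesis using iso that by blast
qed

lemma measure_equivalence_any_type:
  fixes K :: "('k, 'c) monoid_scheme"
  assumes F: "group F" and me: "measure_equivalence F H\<^sub>1 H\<^sub>2 \<alpha>"
    and K: "group K" "finite (carrier K)" and h: "h \<in> hom (F\<lparr>carrier := H\<^sub>2\<rparr>) K"
  shows "Pr F H\<^sub>2 K h = Pr F H\<^sub>1 K (h \<circ> \<alpha>)"
proof -
  obtain K' :: "nat monoid" and g where K': "group K'" "finite (carrier K')" "g \<in> iso K K'"
    using finite_group_iso_nat[OF K] .
  have sub: "H\<^sub>1 \<subseteq> carrier F" "H\<^sub>2 \<subseteq> carrier F" and \<alpha>: "\<alpha> \<in> H\<^sub>1 \<rightarrow> H\<^sub>2"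
    using me by (auto simp: measure_equivalence_def fg_subgroup_def iso_def hom_def subgroup_def)
  have hc: "h \<in> H\<^sub>2 \<rightarrow> carrier K" using h by (auto simp: hom_def)
  have hac: "h \<circ> \<alpha> \<in> H\<^sub>1 \<rightarrow> carrier K" using hc \<alpha> by auto
  have "g \<circ> h \<in> hom (F\<lparr>carrier := H\<^sub>2\<rparr>) K'"
    using h K'(3) by (auto simp: hom_def iso_def Pi_iff)
  then have "Pr F H\<^sub>2 K' (g \<circ> h) = Pr F H\<^sub>1 K' (g \<circ> (h \<circ> \<alpha>))"
    using me K' by (simp add: measure_equivalence_def comp_assoc)
  then show ?thesis
    using Pr_iso[OF F sub(2) K(1) K'(1) K'(3) hc] Pr_iso[OF F sub(1) K(1) K'(1) K'(3) hac]
    by simp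
qed

end

theory Submission
  imports Defs
begin

text \<open>
  Pointwise rigidity clearly implies setwise rigidity. For the converse, let \<open>\<alpha> : H \<rightarrow> L\<close> be a
  measure equivalence. Setwise rigidity provides an automorphism \<open>\<phi>\<close> of \<open>F\<close> with \<open>\<phi>(H) = L\<close>, but
  \<open>\<phi>\<close> and \<open>\<alpha>\<close> may differ on \<open>H\<close>. They differ by the automorphism \<open>\<beta> = \<phi>\<^sup>-\<^sup>1 \<circ> \<alpha>\<close> of \<open>H\<close>, and since
  \<open>F = H * M\<close> for some \<open>M\<close>, the map \<open>\<beta> * id\<close> is an automorphism of \<open>F\<close> extending \<open>\<beta>\<close>
  (\<open>free_factor_iso_extends\<close>). Then \<open>\<phi> \<circ> (\<beta> * id)\<close> is an automorphism of \<open>F\<close> that restricts to \<open>\<alpha>\<close>.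

  What needs work is the existence of \<open>\<beta> * id\<close>, because free products are described by alternating
  words. The universal property of the free product is derived from this description
  (\<open>free_product_hom_exists\<close>, \<open>free_product_hom_unique\<close>); the extension of \<open>\<beta>\<close> is then invertible,
  its inverse being the extension of \<open>\<beta>\<^sup>-\<^sup>1\<close>.
\<close>

lemma word_prod_Nil [simp]: "word_prod G [] = \<one>\<^bsub>G\<^esub>"
  and word_prod_Cons [simp]: "word_prod G (x # w) = x \<otimes>\<^bsub>G\<^esub> word_prod G w"
  by (simp_all add: word_prod_def)

lemma (in monoid) word_prod_closed: "set w \<subseteq> carrier G \<Longrightarrow> word_prod G w \<in> carrier G"
  by (induction w) auto

lemma alternating_word_set: "alternating_word G H M w \<Longrightarrow> set w \<subseteq> H \<union> M"
  by (auto simp: alternating_word_def)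

lemma alternating_word_tail: "alternating_word G H M (t # v) \<Longrightarrow> alternating_word G H M v"
  by (cases v) (auto simp: alternating_word_def)

text \<open>
  A homomorphism on \<open>H * M\<close> is built by applying the given ones to the entries of the alternating
  word of an element. This map respects multiplication from the left by an element \<open>s\<close> of a factor:
  in the alternating word of \<open>x\<close>, the element \<open>s\<close> is either a new first entry, or it merges with the
  first entry, or it cancels the first entry. Since the factors generate \<open>F\<close>, this suffices.
\<close>

lemma free_product_hom_exists:
  assumes F: "group F" and G: "group G" and ifp: "internal_free_product F H M"
    and f: "f \<in> hom (F\<lparr>carrier := H\<rparr>) G" and g: "g \<in> hom (F\<lparr>carrier := M\<rparr>) G"
  obtains k where "k \<in> hom F G" "\<And>x. x \<in> H \<Longrightarrow> k x = f x" "\<And>x. x \<in> M \<Longrightarrow> k x = g x"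
proof -
  interpret F: group F by fact
  interpret G: group G by fact
  have H: "subgroup H F" and M: "subgroup M F" and HM: "H \<inter> M = {\<one>\<^bsub>F\<^esub>}"
    and ex1: "\<And>x. x \<in> carrier F \<Longrightarrow> \<exists>!w. alternating_word F H M w \<and> word_prod F w = x"
    using ifp by (auto simp: internal_free_product_def)
  have sub: "H \<union> M \<subseteq> carrier F"
    using H M by (auto dest: subgroup.subset)
  define b where "b x = (if x \<in> H then f x else g x)" for x
  have f1: "f \<one>\<^bsub>F\<^esub> = \<one>\<^bsub>G\<^esub>" and g1: "g \<one>\<^bsub>F\<^esub> = \<one>\<^bsub>G\<^esub>"
    using hom_one[OF f] hom_one[OF g] G F.subgroup_imp_group[OF H] F.subgroup_imp_group[OF M] by auto
  have bH: "b x = f x" if "x \<in> H" for x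
    using that by (simp add: b_def)
  have bM: "b x = g x" if "x \<in> M" for x
  proof (cases "x \<in> H")
    case True
    then have "x = \<one>\<^bsub>F\<^esub>" using that HM by blast
    then show ?thesis using f1 g1 by (simp add: b_def)
  qed (simp add: b_def)
  have b1: "b \<one>\<^bsub>F\<^esub> = \<one>\<^bsub>G\<^esub>"
    using bH f1 subgroup.one_closed[OF H] by simp
  have bc: "b x \<in> carrier G" if "x \<in> H \<union> M" for x
    using that f g bH bM by (auto simp: hom_def)
  have b_mult: "b (x \<otimes>\<^bsub>F\<^esub> y) = b x \<otimes>\<^bsub>G\<^esub> b y" and mem_mult: "x \<otimes>\<^bsub>F\<^esub> y \<in> H \<union> M"
    if "x \<in> H \<and> y \<in> H \<or> x \<in> M \<and> y \<in> M" for x y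
    using that f g bH bM subgroup.m_closed[OF H] subgroup.m_closed[OF M] by (auto simp: hom_def)
  define nf where "nf x = (THE w. alternating_word F H M w \<and> word_prod F w = x)" for x
  have nf: "alternating_word F H M (nf x)" "word_prod F (nf x) = x" if "x \<in> carrier F" for x
    using theI'[OF ex1[OF that]] by (auto simp: nf_def)
  define k where "k x = word_prod G (map b (nf x))" for x
  have pF: "word_prod F w \<in> carrier F" if "set w \<subseteq> H \<union> M" for w
    using that sub by (intro F.word_prod_closed) auto
  have pG: "word_prod G (map b w) \<in> carrier G" if "set w \<subseteq> H \<union> M" for w
    using that bc by (intro G.word_prod_closed) auto
  have k_word: "k (word_prod F w) = word_prod G (map b w)" if "alternating_word F H M w" for w
  proof -
    have "word_prod F w \<in> carrier F" using pF alternating_word_set[OF that] .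
    then have "nf (word_prod F w) = w" using nf ex1 that by blast
    then show ?thesis by (simp add: k_def)
  qed
  have kc: "k x \<in> carrier G" if "x \<in> carrier F" for x
    using pG alternating_word_set[OF nf(1)[OF that]] by (simp add: k_def)
  have k1: "k \<one>\<^bsub>F\<^esub> = \<one>\<^bsub>G\<^esub>"
    using k_word[of "[]"] by (simp add: alternating_word_def)
  have left: "k (s \<otimes>\<^bsub>F\<^esub> word_prod F w) = b s \<otimes>\<^bsub>G\<^esub> k (word_prod F w)"
    if s: "s \<in> H \<union> M" and w: "alternating_word F H M w" for s w
  proof (cases "s = \<one>\<^bsub>F\<^esub>")
    case True
    then show ?thesis using pF kc alternating_word_set[OF w] b1 by simp
  next
    case s1: False
    show ?thesis
    proof (cases w)
      case Nil
      have "alternating_word F H M [s]" using s s1 by (simp add: alternating_word_def)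
      from k_word[OF this] show ?thesis using Nil k1 by simp
    next
      case (Cons t v)
      note v = alternating_word_tail[OF w[unfolded Cons]]
      have t: "t \<in> H \<union> M" "t \<noteq> \<one>\<^bsub>F\<^esub>"
        using w Cons by (auto simp: alternating_word_def)
      have vc: "word_prod F v \<in> carrier F" using pF alternating_word_set[OF v] .
      have sc: "s \<in> carrier F" "t \<in> carrier F" using s t sub by auto
      have kw: "k (word_prod F w) = b t \<otimes>\<^bsub>G\<^esub> k (word_prod F v)"
        using k_word[OF w] k_word[OF v] Cons by simp
      show ?thesis
      \<comment> \<open>Nontrivial elements lie in at most one factor, so this equivalence says that \<open>s\<close> and \<open>t\<close>
        come from different factors.\<close>
      proof (cases "s \<in> H \<longleftrightarrow> t \<in> M")
        case True
        then have "alternating_word F H M (s # w)"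
          using s s1 w Cons by (auto simp: alternating_word_def)
        from k_word[OF this] show ?thesis using k_word[OF w] by simp
      next
        case False
        then have same: "s \<in> H \<and> t \<in> H \<or> s \<in> M \<and> t \<in> M" using s t by blast
        have assoc: "s \<otimes>\<^bsub>F\<^esub> word_prod F w = (s \<otimes>\<^bsub>F\<^esub> t) \<otimes>\<^bsub>F\<^esub> word_prod F v"
          using Cons vc sc by (simp add: F.m_assoc)
        have "k ((s \<otimes>\<^bsub>F\<^esub> t) \<otimes>\<^bsub>F\<^esub> word_prod F v) = b (s \<otimes>\<^bsub>F\<^esub> t) \<otimes>\<^bsub>G\<^esub> k (word_prod F v)"
        proof (cases "s \<otimes>\<^bsub>F\<^esub> t = \<one>\<^bsub>F\<^esub>")
          case True
          then show ?thesis using vc kc b1 by simp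
        next
          case st1: False
          have "s \<otimes>\<^bsub>F\<^esub> t \<in> H \<longleftrightarrow> t \<in> H"
          proof -
            have "s \<otimes>\<^bsub>F\<^esub> t \<in> H" if "t \<in> H"
              using that same t HM subgroup.m_closed[OF H] by blast
            moreover have "s \<otimes>\<^bsub>F\<^esub> t \<in> M" if "t \<notin> H"
              using that same subgroup.m_closed[OF M] by blast
            ultimately show ?thesis using st1 HM by blast
          qed
          then have "alternating_word F H M ((s \<otimes>\<^bsub>F\<^esub> t) # v)"
            using w Cons st1 mem_mult[OF same] by (cases v) (auto simp: alternating_word_def)
          from k_word[OF this] show ?thesis using k_word[OF v] by simp
        qed
        then show ?thesis
          using assoc kw b_mult[OF same] bc[OF s] bc[OF t(1)] kc[OF vc] by (simp add: G.m_assoc)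
      qed
    qed
  qed
  have left': "k (s \<otimes>\<^bsub>F\<^esub> y) = b s \<otimes>\<^bsub>G\<^esub> k y" if "s \<in> H \<union> M" "y \<in> carrier F" for s y
    using left[OF that(1) nf(1)[OF that(2)]] nf(2)[OF that(2)] by simp
  have word_left: "k (word_prod F w \<otimes>\<^bsub>F\<^esub> y) = word_prod G (map b w) \<otimes>\<^bsub>G\<^esub> k y"
    if "set w \<subseteq> H \<union> M" "y \<in> carrier F" for w y
    using that(1)
  proof (induction w)
    case Nil
    then show ?case using that(2) kc by simp
  next
    case (Cons s w)
    have s: "s \<in> H \<union> M" and w: "set w \<subseteq> H \<union> M" using Cons.prems by auto
    have "s \<in> carrier F" using s sub by blast
    then show ?case
      using Cons.IH[OF w] left'[OF s, of "word_prod F w \<otimes>\<^bsub>F\<^esub> y"] that(2) pF[OF w] pG[OF w]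
        bc[OF s] kc[OF that(2)] by (simp add: F.m_assoc G.m_assoc)
  qed
  have "k \<in> hom F G"
  proof (rule homI)
    fix x y assume x: "x \<in> carrier F" and y: "y \<in> carrier F"
    show "k (x \<otimes>\<^bsub>F\<^esub> y) = k x \<otimes>\<^bsub>G\<^esub> k y"
      using word_left[OF alternating_word_set[OF nf(1)[OF x]] y] nf(2)[OF x] by (simp add: k_def)
  qed (rule kc)
  moreover have "k x = b x" if "x \<in> H \<union> M" for x
  proof -
    have "x \<in> carrier F" using that sub by blast
    then show ?thesis using left'[OF that, of "\<one>\<^bsub>F\<^esub>"] k1 bc[OF that] by simp
  qed
  ultimately show ?thesis using that[of k] bH bM by simp
qed

lemma free_product_hom_unique:
  assumes F: "group F" and G: "group G" and ifp: "internal_free_product F H M"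
    and k: "k \<in> hom F G" "l \<in> hom F G"
    and eq: "\<And>x. x \<in> H \<union> M \<Longrightarrow> k x = l x" and x: "x \<in> carrier F"
  shows "k x = l x"
proof -
  interpret F: group F by fact
  have sub: "H \<union> M \<subseteq> carrier F"
    using ifp by (auto simp: internal_free_product_def dest: subgroup.subset)
  have "k (word_prod F w) = l (word_prod F w)" if "set w \<subseteq> H \<union> M" for w
    using that
  proof (induction w)
    case Nil
    then show ?case using hom_one[OF k(1) F G] hom_one[OF k(2) F G] by simp
  next
    case (Cons s w)
    have "s \<in> carrier F" "word_prod F w \<in> carrier F"
      using Cons.prems sub by (auto intro!: F.word_prod_closed)
    then show ?case using Cons eq k by (simp add: hom_mult)
  qed
  moreover obtain w where "alternating_word F H M w" "word_prod F w = x"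
    using ifp x by (auto simp: internal_free_product_def)
  ultimately show ?thesis using alternating_word_set by metis
qed

text \<open>
  With \<open>F = H * M\<close>, the extension is \<open>\<beta> * id\<close>; the uniqueness part of the universal property shows
  that \<open>\<beta>\<^sup>-\<^sup>1 * id\<close> is inverse to it. It is restricted to the carrier because members of \<open>auto F\<close> are
  extensional.
\<close>

lemma free_factor_iso_extends:
  assumes F: "group F" and ff: "free_factor H F"
    and \<beta>: "\<beta> \<in> iso (F\<lparr>carrier := H\<rparr>) (F\<lparr>carrier := H\<rparr>)"
  obtains \<psi> where "\<psi> \<in> auto F" "\<And>x. x \<in> H \<Longrightarrow> \<psi> x = \<beta> x"
proof -
  interpret F: group F by fact
  obtain M where ifp: "internal_free_product F H M"
    using ff by (auto simp: free_factor_def)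
  then have H: "subgroup H F" and M: "subgroup M F"
    by (auto simp: internal_free_product_def)
  have sub: "H \<subseteq> carrier F" "M \<subseteq> carrier F"
    using H M by (auto dest: subgroup.subset)
  define \<gamma> where "\<gamma> = inv_into H \<beta>"
  have bij: "bij_betw \<beta> H H" using \<beta> by (simp add: iso_def)
  have \<gamma>: "\<gamma> \<in> iso (F\<lparr>carrier := H\<rparr>) (F\<lparr>carrier := H\<rparr>)"
    using group.iso_set_sym[OF F.subgroup_imp_group[OF H] \<beta>] by (simp add: \<gamma>_def)
  have inv: "\<beta> x \<in> H" "\<gamma> x \<in> H" "\<gamma> (\<beta> x) = x" "\<beta> (\<gamma> x) = x" if "x \<in> H" for x
    using that bij \<gamma> by (auto simp: \<gamma>_def iso_def hom_def bij_betw_def inv_into_into f_inv_into_f)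
  have idM: "(\<lambda>x. x) \<in> hom (F\<lparr>carrier := M\<rparr>) F" using sub by (auto simp: hom_def)
  have \<beta>h: "\<beta> \<in> hom (F\<lparr>carrier := H\<rparr>) F" and \<gamma>h: "\<gamma> \<in> hom (F\<lparr>carrier := H\<rparr>) F"
    using \<beta> \<gamma> sub by (auto simp: iso_def hom_def)
  obtain k where k: "k \<in> hom F F" "\<And>x. x \<in> H \<Longrightarrow> k x = \<beta> x" "\<And>x. x \<in> M \<Longrightarrow> k x = x"
    using free_product_hom_exists[OF F F ifp \<beta>h idM] by metis
  obtain l where l: "l \<in> hom F F" "\<And>x. x \<in> H \<Longrightarrow> l x = \<gamma> x" "\<And>x. x \<in> M \<Longrightarrow> l x = x"
    using free_product_hom_exists[OF F F ifp \<gamma>h idM] by metis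
  have id: "(\<lambda>x. x) \<in> hom F F" by (auto simp: hom_def)
  have on_factors: "(l \<circ> k) x = x" "(k \<circ> l) x = x" if "x \<in> H \<union> M" for x
    using that k l inv by auto
  have lk: "l (k x) = x" if "x \<in> carrier F" for x
    using free_product_hom_unique[OF F F ifp hom_compose[OF k(1) l(1)] id on_factors(1) that] by simp
  have kl: "k (l x) = x" if "x \<in> carrier F" for x
    using free_product_hom_unique[OF F F ifp hom_compose[OF l(1) k(1)] id on_factors(2) that] by simp
  have "bij_betw k (carrier F) (carrier F)"
    using k(1) l(1) lk kl by (intro bij_betw_byWitness[where f' = l]) (auto simp: hom_def)
  then have "restrict k (carrier F) \<in> auto F"
    using k(1) by (auto simp: auto_def Bij_def hom_def)
  moreover have "restrict k (carrier F) x = \<beta> x" if "x \<in> H" for x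
    using that k(2) sub by auto
  ultimately show ?thesis by (rule that)
qed

theorem corollary1p7:
  fixes F :: "('a, 'b) monoid_scheme" and H :: "'a set"
  assumes "fg_free_group F"
    and "free_factor H F"
  shows "profinitely_rigid H F \<longleftrightarrow> setwise_profinitely_rigid H F"
proof
  assume "profinitely_rigid H F"
  then show "setwise_profinitely_rigid H F"
    unfolding profinitely_rigid_def setwise_profinitely_rigid_def measure_equivalent_def by metis
next
  assume setwise: "setwise_profinitely_rigid H F"
  interpret F: group F
    using assms(1) by (simp add: fg_free_group_def free_group_def)
  show "profinitely_rigid H F"
    unfolding profinitely_rigid_def
  proof (intro allI impI, elim conjE)
    fix L \<alpha> assume L: "fg_subgroup L F" and me: "measure_equivalence F H L \<alpha>"
    have H: "subgroup H F" and \<alpha>: "\<alpha> \<in> iso (F\<lparr>carrier := H\<rparr>) (F\<lparr>carrier := L\<rparr>)"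
      using me by (auto simp: measure_equivalence_def fg_subgroup_def)
    have HF: "H \<subseteq> carrier F" using H by (rule subgroup.subset)
    obtain \<phi> where \<phi>: "\<phi> \<in> auto F" and img: "L = \<phi> ` H"
      using setwise L me unfolding setwise_profinitely_rigid_def measure_equivalent_def by blast
    have \<phi>h: "\<phi> \<in> hom F F" and \<phi>b: "bij_betw \<phi> (carrier F) (carrier F)"
      using \<phi> by (auto simp: auto_def Bij_def)
    have \<phi>H: "\<phi> \<in> iso (F\<lparr>carrier := H\<rparr>) (F\<lparr>carrier := L\<rparr>)"
      using \<phi>h \<phi>b img HF by (auto simp: iso_def hom_def bij_betw_def Pi_iff subset_iff intro: inj_on_subset)
    define \<beta> where "\<beta> = inv_into H \<phi> \<circ> \<alpha>"
    have "\<beta> \<in> iso (F\<lparr>carrier := H\<rparr>) (F\<lparr>carrier := H\<rparr>)"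
      using iso_set_trans[OF \<alpha> group.iso_set_sym[OF F.subgroup_imp_group[OF H] \<phi>H]]
      by (simp add: \<beta>_def)
    then obtain \<psi> where \<psi>: "\<psi> \<in> auto F" "\<And>x. x \<in> H \<Longrightarrow> \<psi> x = \<beta> x"
      using free_factor_iso_extends[OF F.is_group assms(2)] by blast
    have \<psi>h: "\<psi> \<in> hom F F" and \<psi>b: "bij_betw \<psi> (carrier F) (carrier F)"
      using \<psi>(1) by (auto simp: auto_def Bij_def)
    define \<theta> where "\<theta> = compose (carrier F) \<phi> \<psi>"
    have "\<theta> \<in> auto F"
      using bij_betw_trans[OF \<psi>b \<phi>b] \<phi>h \<psi>h
      by (auto simp: \<theta>_def auto_def Bij_def hom_def compose_def Pi_iff comp_def cong: bij_betw_cong)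
    moreover have \<theta>\<alpha>: "\<theta> x = \<alpha> x" if "x \<in> H" for x
    proof -
      have "\<alpha> x \<in> \<phi> ` H" using \<alpha> that img by (auto simp: iso_def hom_def)
      then show ?thesis using that HF \<psi>(2) by (auto simp: \<theta>_def compose_def \<beta>_def f_inv_into_f)
    qed
    moreover have "\<theta> ` H = L"
    proof -
      have "\<theta> ` H = \<alpha> ` H" using \<theta>\<alpha> by (rule image_cong[OF refl])
      also have "\<dots> = L" using \<alpha> by (simp add: iso_def bij_betw_def)
      finally show ?thesis .
    qed
    ultimately show "\<exists>\<phi>\<in>auto F. \<phi> ` H = L \<and> (\<forall>x\<in>H. \<phi> x = \<alpha> x)" by blast
  qed
qed

end
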